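(* The poset of equivalence classes of $\sim$ in $\mathfrak S$ with the partial order $\preccurlyeq$ is a lattice where the operations of the greatest lower bound and the least upper bound are $\wedge$ and $\vee$, respectively.
   Context: $\Gamma=(\Gamma_0,\Gamma_1)$ is a finite connected graph (multiple edges allowed) without loops and with more than one vertex. An orientation $\Lambda$ on $\Gamma$ chooses for each edge a starting point and an endpoint among its incident vertices, giving a quiver $(\Gamma,\Lambda)$; all orientations are assumed to have no oriented cycles. A sink is a vertex at which no arrow starts. $\sigma_x\Lambda$ is the orientation obtained by reversing all arrows incident with $x$. A finite sequence $S=x_1,\dots,x_s$ of vertices ($s\ge 0$) is (+)-admissible on $(\Gamma,\Lambda)$ if $x_1$ is a sink for $\Lambda$, $x_2$ is a sink for $\sigma_{x_1}\Lambda$, and so on; put $\Lambda^S=\sigma_{x_s}\cdots\sigma_{x_1}\Lambda$. $\mathfrak S$ is the set of (+)-admissible sequences on $(\Gamma,\Lambda)$. $\sim$ is the equivalence relation on $\mathfrak S$ generated by interchanging two consecutive terms $x_i,x_{i+1}$ that are not connected by an edge of $\Gamma$. For $S,T\in\mathfrak S$, $S\preccurlyeq T$ means $T\sim SU$ (concatenation) for some (+)-admissible sequence $U$ on $(\Gamma,\Lambda^S)$; this is a preorder with $S\preccurlyeq T\preccurlyeq S$ iff $S\sim T$, so it induces a partial order on the $\sim$-classes. $\mathrm{Supp}\,S$ is the set of vertices occurring in $S$. Canonical form: every nonempty $S\in\mathfrak S$ satisfies $S\sim S_1\cdots S_r$ where each segment $S_i$ is nonempty, consists of distinct vertices, and $\mathrm{Supp}\,S_i=\mathrm{Supp}\,S_iS_{i+1}\cdots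 S_r$; $r$ and the segments up to equivalence are determined by $S$, and $S$ is determined up to $\sim$ by the sets $\mathrm{Supp}\,S_1,\dots,\mathrm{Supp}\,S_r$. Definition of $\wedge,\vee$ (up to $\sim$): let $S,T$ be nonempty with canonical forms $S_1\cdots S_r$, $T_1\cdots T_q$, $r\le q$. $S\wedge T$ is the sequence in $\mathfrak S$ with canonical form $R_1\cdots R_r$ (empty segments being omitted) where $\mathrm{Supp}\,R_i=\mathrm{Supp}\,S_i\cap\mathrm{Supp}\,T_i$ for $0<i\le r$. $S\vee T$ is the sequence in $\mathfrak S$ with canonical form $R_1\cdots R_q$ where $\mathrm{Supp}\,R_i=\mathrm{Supp}\,S_i\cup\mathrm{Supp}\,T_i$ for $0<i\le r$ and $\mathrm{Supp}\,R_i=\mathrm{Supp}\,T_i$ for $r<i\le q$. For the empty sequence $\emptyset$: $S\wedge\emptyset=\emptyset$ and $S\vee\emptyset=S$. (That such sequences exist in $\mathfrak S$ is part of the assertion.) *)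

theory Defs
  imports "Graph_Theory.Digraph_Component" "HOL-Algebra.Lattice"
begin

text \<open>
  A digraph \<open>G\<close> with possibly multiple arcs stands for the quiver given by an undirected multigraph
  together with an orientation: the vertices and edges of the multigraph are \<open>verts G\<close> and
  \<open>arcs G\<close>, the edge \<open>e\<close> joins \<open>tail G e\<close> and \<open>head G e\<close>, and the orientation directs it from the
  former to the latter. The predicate \<open>connected\<close> refers to the underlying undirected graph, whereas
  \<open>pre_digraph.cycle\<close> refers to oriented cycles.
\<close>

locale acyclic_quiver = fin_digraph + loopfree_digraph +
  assumes connected: "connected G"
    and more_than_one_vertex: "card (verts G) > 1"
    and no_oriented_cycle: "\<not> (\<exists>p. pre_digraph.cycle G p)"

definition sink :: "('a, 'b) pre_digraph \<Rightarrow> 'a \<Rightarrow> bool" where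
  "sink G x \<longleftrightarrow> x \<in> verts G \<and> out_arcs G x = {}"

definition reflect :: "'a \<Rightarrow> ('a, 'b) pre_digraph \<Rightarrow> ('a, 'b) pre_digraph" where
  "reflect x G = G\<lparr>
     tail := \<lambda>e. if tail G e = x \<or> head G e = x then head G e else tail G e,
     head := \<lambda>e. if tail G e = x \<or> head G e = x then tail G e else head G e\<rparr>"

definition reflect_seq :: "'a list \<Rightarrow> ('a, 'b) pre_digraph \<Rightarrow> ('a, 'b) pre_digraph" where
  "reflect_seq S G = fold reflect S G"

fun admissible :: "('a, 'b) pre_digraph \<Rightarrow> 'a list \<Rightarrow> bool" where
  "admissible G [] \<longleftrightarrow> True"
| "admissible G (x # S) \<longleftrightarrow> sink G x \<and> admissible (reflect x G) S"

definition adjacent :: "('a, 'b) pre_digraph \<Rightarrow> 'a \<Rightarrow> 'a \<Rightarrow> bool" where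
  "adjacent G x y \<longleftrightarrow> x \<rightarrow>\<^bsub>G\<^esub> y \<or> y \<rightarrow>\<^bsub>G\<^esub> x"

definition swap_step :: "('a, 'b) pre_digraph \<Rightarrow> 'a list \<Rightarrow> 'a list \<Rightarrow> bool" where
  "swap_step G S T \<longleftrightarrow> admissible G S \<and> admissible G T \<and>
     (\<exists>A x y B. S = A @ [x, y] @ B \<and> T = A @ [y, x] @ B \<and> \<not> adjacent G x y)"

definition seq_equiv :: "('a, 'b) pre_digraph \<Rightarrow> 'a list \<Rightarrow> 'a list \<Rightarrow> bool" where
  "seq_equiv G S T \<longleftrightarrow> admissible G S \<and> admissible G T \<and> equivclp (swap_step G) S T"

definition seq_le :: "('a, 'b) pre_digraph \<Rightarrow> 'a list \<Rightarrow> 'a list \<Rightarrow> bool" where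
  "seq_le G S T \<longleftrightarrow> admissible G S \<and> admissible G T \<and>
     (\<exists>U. admissible (reflect_seq S G) U \<and> seq_equiv G T (S @ U))"

definition seq_class :: "('a, 'b) pre_digraph \<Rightarrow> 'a list \<Rightarrow> 'a list set" where
  "seq_class G S = {(S, T). seq_equiv G S T} `` {S}"

definition seq_poset :: "('a, 'b) pre_digraph \<Rightarrow> 'a list set gorder" where
  "seq_poset G = \<lparr>carrier = {S. admissible G S} // {(S, T). seq_equiv G S T}, eq = (=),
     le = \<lambda>X Y. \<exists>S\<in>X. \<exists>T\<in>Y. seq_le G S T\<rparr>"

definition canonical_form :: "('a, 'b) pre_digraph \<Rightarrow> 'a list \<Rightarrow> 'a list list \<Rightarrow> bool" where
  "canonical_form G S Ss \<longleftrightarrow> seq_equiv G S (concat Ss) \<and>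
     (\<forall>i<length Ss. Ss ! i \<noteq> [] \<and> distinct (Ss ! i) \<and> set (Ss ! i) = set (concat (drop i Ss)))"

text \<open>The \<open>i\<close>-th support (counting from 0), taken to be empty beyond the last segment.\<close>

definition segment_supp :: "'a list list \<Rightarrow> nat \<Rightarrow> 'a set" where
  "segment_supp Ss i = (if i < length Ss then set (Ss ! i) else {})"

text \<open>
  The operations are defined only up to equivalence of sequences, so they are given as relations:
  \<open>R\<close> is one of the sequences representing the result of the operation on \<open>S\<close> and \<open>T\<close>.
  Taking the minimum and the maximum of the lengths covers both orders of the lengths of the
  two canonical forms.
\<close>

definition is_wedge :: "('a, 'b) pre_digraph \<Rightarrow> 'a list \<Rightarrow> 'a list \<Rightarrow> 'a list \<Rightarrow> bool" where
  "is_wedge G S T R \<longleftrightarrow>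
     (if S = [] \<or> T = [] then seq_equiv G R []
      else \<exists>Ss Ts Rs. canonical_form G S Ss \<and> canonical_form G T Ts \<and>
        length Rs = min (length Ss) (length Ts) \<and>
        (\<forall>i<length Rs. set (Rs ! i) = segment_supp Ss i \<inter> segment_supp Ts i) \<and>
        canonical_form G R (filter (\<lambda>seg. seg \<noteq> []) Rs))"

definition is_vee :: "('a, 'b) pre_digraph \<Rightarrow> 'a list \<Rightarrow> 'a list \<Rightarrow> 'a list \<Rightarrow> bool" where
  "is_vee G S T R \<longleftrightarrow>
     (if T = [] then seq_equiv G R S
      else if S = [] then seq_equiv G R T
      else \<exists>Ss Ts Rs. canonical_form G S Ss \<and> canonical_form G T Ts \<and>
        length Rs = max (length Ss) (length Ts) \<and>
        (\<forall>i<length Rs. set (Rs ! i) = segment_supp Ss i \<union> segment_supp Ts i) \<and>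
        canonical_form G R Rs)"

end

theory Submission
  imports Defs "HOL-Library.Multiset"
begin

text \<open>
  Reflections at any two vertices commute, so everything about an admissible sequence \<open>S\<close> except
  the order of its letters is recorded by the multiset of its letters, and this multiset
  embeds the poset into multisets of vertices ordered by inclusion.

  Along an arc from \<open>u\<close> to \<open>v\<close> the two ends are used alternately, beginning with \<open>v\<close>. Hence the
  multiplicity of \<open>v\<close> equals that of \<open>u\<close> or exceeds it by one; such multisets are called feasible
  here, and a sequence is admissible exactly if all its prefixes have feasible multisets
  (\<open>admissible_snoc\<close>). Two facts make the embedding exact. If one feasible multiset is
  contained in another, a single letter can be added to the smaller one without leaving the feasible
  multisets (\<open>feasible_step\<close>), so every feasible multiset arises from an admissible sequence, which
  may moreover be chosen to prolong any given sequence for a smaller multiset; this is where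
  acyclicity enters. And two admissible sequences with the same multiset are equivalent
  (\<open>swap_equiv_if_mset_eq\<close>), because no neighbour of the last letter of one of them can
  follow the last occurrence of that letter in the other. So equivalence and preorder of sequences
  are equality and inclusion of multisets.

  The feasible multisets are closed under pointwise minimum and maximum, which proves the
  lattice property. It remains to recognise these operations in the canonical forms: the segments
  have decreasing supports, so the \<open>i\<close>-th support consists of the letters occurring more than \<open>i\<close>
  times (\<open>segment_supp_canonical\<close>), and intersections and unions of supports are minima and maxima of
  multiplicities.
\<close>

section \<open>Reflections and multiplicities\<close>

lemma reflect_commute: "reflect x (reflect y G) = reflect y (reflect x G)"
  unfolding reflect_def by (rule pre_digraph.equality) (auto simp: fun_eq_iff)

lemma reflect_seq_cong_mset:
  assumes "mset S = mset T"
  shows "reflect_seq S G = reflect_seq T G"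
proof -
  have "fold reflect S = fold reflect T"
    by (rule fold_multiset_equiv) (auto simp: fun_eq_iff reflect_commute assms)
  then show ?thesis
    unfolding reflect_seq_def by (rule fun_cong)
qed

lemma reflect_seq_snoc: "reflect_seq (S @ [x]) G = reflect x (reflect_seq S G)"
  by (simp add: reflect_seq_def)

lemma verts_reflect_seq: "verts (reflect_seq S G) = verts G"
  by (induction S rule: rev_induct) (simp_all add: reflect_seq_def reflect_def)

lemma arcs_reflect_seq: "arcs (reflect_seq S G) = arcs G"
  by (induction S rule: rev_induct) (simp_all add: reflect_seq_def reflect_def)

text \<open>Each occurrence of an end of an arc reverses that arc once.\<close>

lemma ends_reflect_seq:
  assumes "tail G e \<noteq> head G e"
  defines "k \<equiv> \<lambda>S. count (mset S) (tail G e) + count (mset S) (head G e)"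
  shows "tail (reflect_seq S G) e = (if even (k S) then tail G e else head G e)"
    and "head (reflect_seq S G) e = (if even (k S) then head G e else tail G e)"
proof -
  have "tail (reflect_seq S G) e = (if even (k S) then tail G e else head G e) \<and>
    head (reflect_seq S G) e = (if even (k S) then head G e else tail G e)"
  proof (induction S rule: rev_induct)
    case Nil
    then show ?case by (simp add: reflect_seq_def k_def)
  next
    case (snoc x S)
    then show ?case
      using assms(1) by (auto simp: reflect_seq_snoc reflect_def k_def)
  qed
  then show "tail (reflect_seq S G) e = (if even (k S) then tail G e else head G e)"
    and "head (reflect_seq S G) e = (if even (k S) then head G e else tail G e)"
    by blast+
qed

lemma admissible_append:
  "admissible G (S @ T) \<longleftrightarrow> admissible G S \<and> admissible (reflect_seq S G) T"
  by (induction S arbitrary: G) (auto simp: reflect_seq_def)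

section \<open>Feasible multisets\<close>

definition feasible :: "('a, 'b) pre_digraph \<Rightarrow> 'a multiset \<Rightarrow> bool" where
  "feasible G M \<longleftrightarrow> set_mset M \<subseteq> verts G \<and>
     (\<forall>e\<in>arcs G. count M (tail G e) \<le> count M (head G e) \<and>
                 count M (head G e) \<le> count M (tail G e) + 1)"

lemma feasible_arcD:
  assumes "feasible G M" "e \<in> arcs G"
  shows "count M (tail G e) \<le> count M (head G e)"
    and "count M (head G e) \<le> count M (tail G e) + 1"
  using assms unfolding feasible_def by auto

lemma feasible_inter:
  assumes "feasible G M" "feasible G N"
  shows "feasible G (M \<inter># N)"
  unfolding feasible_def
proof (intro conjI ballI)
  show "set_mset (M \<inter># N) \<subseteq> verts G"
    using assms by (auto simp: feasible_def)
next
  fix e assume e: "e \<in> arcs G"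
  note arc = feasible_arcD[OF assms(1) e] feasible_arcD[OF assms(2) e]
  show "count (M \<inter># N) (tail G e) \<le> count (M \<inter># N) (head G e)"
    and "count (M \<inter># N) (head G e) \<le> count (M \<inter># N) (tail G e) + 1"
    using arc by auto
qed

lemma feasible_union:
  assumes "feasible G M" "feasible G N"
  shows "feasible G (M \<union># N)"
  unfolding feasible_def
proof (intro conjI ballI)
  show "set_mset (M \<union># N) \<subseteq> verts G"
    using assms by (auto simp: feasible_def)
next
  fix e assume e: "e \<in> arcs G"
  note arc = feasible_arcD[OF assms(1) e] feasible_arcD[OF assms(2) e]
  show "count (M \<union># N) (tail G e) \<le> count (M \<union># N) (head G e)"
    and "count (M \<union># N) (head G e) \<le> count (M \<union># N) (tail G e) + 1"
    using arc by auto
qed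

context loopfree_digraph
begin

text \<open>
  Feasibility makes the parity in \<open>ends_reflect_seq\<close> informative: an arc keeps its original
  direction iff its ends have equal multiplicities. The letter \<open>x\<close> is a sink iff no arc
  points away from it, and this is the condition for every arc at \<open>x\<close> to tolerate one more \<open>x\<close>.
\<close>

lemma sink_iff_feasible:
  assumes "feasible G (mset S)"
  shows "sink (reflect_seq S G) x \<longleftrightarrow> feasible G (add_mset x (mset S))"
proof -
  let ?m = "count (mset S)" and ?n = "count (add_mset x (mset S))"
  have tail: "tail (reflect_seq S G) e \<noteq> x \<longleftrightarrow>
      ?n (tail G e) \<le> ?n (head G e) \<and> ?n (head G e) \<le> ?n (tail G e) + 1"
    if e: "e \<in> arcs G" for e
  proof -
    have ne: "tail G e \<noteq> head G e" using no_loops e by blast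
    have "?m (head G e) = ?m (tail G e) \<or> ?m (head G e) = ?m (tail G e) + 1"
      using feasible_arcD[OF assms e] by linarith
    then show ?thesis
      using ne by (auto simp: ends_reflect_seq[OF ne])
  qed
  have "sink (reflect_seq S G) x \<longleftrightarrow>
      x \<in> verts G \<and> (\<forall>e\<in>arcs G. tail (reflect_seq S G) e \<noteq> x)"
    by (auto simp: sink_def out_arcs_def verts_reflect_seq arcs_reflect_seq)
  also have "\<dots> \<longleftrightarrow> feasible G (add_mset x (mset S))"
    using assms tail by (auto simp: feasible_def)
  finally show ?thesis .
qed

lemma feasible_mset_if_admissible:
  "admissible G S \<Longrightarrow> feasible G (mset S)"
proof (induction S rule: rev_induct)
  case Nil
  then show ?case by (simp add: feasible_def)
next
  case (snoc x S)
  then show ?case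
    by (simp add: admissible_append sink_iff_feasible)
qed

lemma admissible_snoc:
  "admissible G (S @ [x]) \<longleftrightarrow> admissible G S \<and> feasible G (add_mset x (mset S))"
  using feasible_mset_if_admissible[of S] sink_iff_feasible[of S x]
  by (auto simp: admissible_append)

lemma admissible_append_cong_mset:
  assumes "admissible G (S @ U)" "admissible G T" "mset S = mset T"
  shows "admissible G (T @ U)"
  using assms reflect_seq_cong_mset[OF assms(3), of G] by (simp add: admissible_append)

section \<open>Equivalence is equality of multisets\<close>

text \<open>
  Let \<open>y\<close> be a neighbour of \<open>x\<close>. If both \<open>A\<close> and \<open>A + x\<close> are feasible, then the
  multiplicity of \<open>y\<close> in \<open>A\<close> is determined by that of \<open>x\<close>, and the same holds in \<open>M\<close>.
\<close>

lemma count_neighbour_eq: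
  assumes "feasible G A" "feasible G (add_mset x A)"
    and "feasible G M" "feasible G (add_mset x M)"
    and "count A x = count M x" and "adjacent G x y"
  shows "count A y = count M y"
proof -
  obtain e where e: "e \<in> arcs G" "tail G e = x \<and> head G e = y \<or> tail G e = y \<and> head G e = x"
    using assms(6) by (auto simp: adjacent_def arcs_ends_conv)
  have "x \<noteq> y"
    using no_loops[OF e(1)] e(2) by auto
  then show ?thesis
    using e(2) assms(5) feasible_arcD[OF assms(1) e(1)] feasible_arcD[OF assms(2) e(1)]
      feasible_arcD[OF assms(3) e(1)] feasible_arcD[OF assms(4) e(1)]
    by auto
qed

text \<open>
  If neither of \<open>x\<close>, \<open>y\<close> constrains the other, the order in which they are added does not
  matter for feasibility.
\<close>

lemma feasible_add_commute:
  assumes "feasible G A" "feasible G (add_mset x A)" "feasible G (add_mset y (add_mset x A))"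
    and "\<not> adjacent G x y"
  shows "feasible G (add_mset y A)"
  unfolding feasible_def
proof (intro conjI ballI)
  show "set_mset (add_mset y A) \<subseteq> verts G"
    using assms(3) by (auto simp: feasible_def)
next
  fix e assume e: "e \<in> arcs G"
  have "\<not> (tail G e = x \<and> head G e = y)" "\<not> (tail G e = y \<and> head G e = x)"
    using assms(4) e by (auto simp: adjacent_def arcs_ends_conv)
  then have "count (add_mset y A) (tail G e) \<le> count (add_mset y A) (head G e) \<and>
      count (add_mset y A) (head G e) \<le> count (add_mset y A) (tail G e) + 1"
    using feasible_arcD[OF assms(1) e] feasible_arcD[OF assms(3) e] no_loops[OF e]
    by (auto split: if_splits)
  then show "count (add_mset y A) (tail G e) \<le> count (add_mset y A) (head G e)"
    and "count (add_mset y A) (head G e) \<le> count (add_mset y A) (tail G e) + 1"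
    by auto
qed

lemma swap_step_append:
  assumes "swap_step G S T" "admissible G (S @ U)" "admissible G (T @ U)"
  shows "swap_step G (S @ U) (T @ U)"
proof -
  obtain A x y B where "S = A @ [x, y] @ B" "T = A @ [y, x] @ B" "\<not> adjacent G x y"
    using assms(1) by (auto simp: swap_step_def)
  then show ?thesis
    unfolding swap_step_def using assms(2,3)
    by (intro conjI exI[of _ A] exI[of _ x] exI[of _ y] exI[of _ "B @ U"]) auto
qed

lemma equivclp_swap_append:
  assumes "equivclp (swap_step G) S T" "admissible G (S @ U)"
  shows "equivclp (swap_step G) (S @ U) (T @ U) \<and> admissible G (T @ U)"
  using assms(1)
proof (induction rule: equivclp_induct)
  case base
  then show ?case using assms(2) by auto
next
  case (step Y Z)
  have YZ: "swap_step G Y Z \<or> swap_step G Z Y" using step.hyps by blast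
  then have adm: "admissible G Z" and mset: "mset Y = mset Z"
    by (auto simp: swap_step_def)
  have ZU: "admissible G (Z @ U)"
    using admissible_append_cong_mset[OF _ adm mset] step.IH by blast
  have "swap_step G (Y @ U) (Z @ U) \<or> swap_step G (Z @ U) (Y @ U)"
    using YZ swap_step_append step.IH ZU by blast
  then have "equivclp (swap_step G) (Y @ U) (Z @ U)"
    by (auto intro: equivclp_sym)
  then show ?case
    using step.IH ZU equivclp_trans by metis
qed

text \<open>
  Since the multiset of \<open>A @ B\<close> is feasible, \<open>x\<close> may be added either to \<open>A\<close> or to \<open>A @ B\<close>, and its
  multiplicity beforehand is the same. By \<open>count_neighbour_eq\<close> no neighbour
  of \<open>x\<close> occurs in \<open>B\<close>, so \<open>x\<close> can be moved across \<open>B\<close> letter by letter.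
\<close>

lemma swap_equiv_move_to_end:
  assumes "admissible G (A @ x # B)" "x \<notin> set B" "feasible G (mset (A @ B))"
  shows "equivclp (swap_step G) (A @ x # B) (A @ B @ [x]) \<and> admissible G (A @ B @ [x])"
  using assms
proof (induction B arbitrary: A)
  case Nil
  then show ?case by simp
next
  case (Cons b B)
  have pre: "admissible G ((A @ [x, b]) @ B)"
    using Cons.prems(1) by simp
  then have adm: "admissible G (A @ [x, b])" "admissible G (A @ [x])" "admissible G A"
    using admissible_append[of G "A @ [x]" "[b]"] admissible_append[of G A "[x]"]
      admissible_append[of G "A @ [x, b]" B] by auto
  have fA: "feasible G (mset A)" and fAx: "feasible G (add_mset x (mset A))"
    and fAxb: "feasible G (add_mset b (add_mset x (mset A)))"
    using adm[THEN feasible_mset_if_admissible] by (simp_all add: add_mset_commute)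
  have nadj: "\<not> adjacent G x b"
  proof
    assume adj: "adjacent G x b"
    have "feasible G (add_mset x (mset (A @ b # B)))"
      using feasible_mset_if_admissible[OF Cons.prems(1)] by simp
    moreover have "count (mset A) x = count (mset (A @ b # B)) x"
      using Cons.prems(2) by (auto simp: count_eq_zero_iff)
    ultimately have "count (mset A) b = count (mset (A @ b # B)) b"
      by (intro count_neighbour_eq[OF fA fAx Cons.prems(3) _ _ adj])
    then show False by simp
  qed
  have fAb: "feasible G (add_mset b (mset A))"
    by (rule feasible_add_commute[OF fA fAx fAxb nadj])
  have "admissible G (A @ [b])"
    using adm(3) fAb by (simp add: admissible_snoc)
  then have "admissible G ((A @ [b]) @ [x])"
    using fAxb unfolding admissible_snoc[of "A @ [b]"] by (simp add: add_mset_commute)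
  then have swapped: "admissible G ((A @ [b]) @ x # B)"
    using admissible_append_cong_mset[OF pre, of "A @ [b, x]"] by simp
  have "swap_step G (A @ x # b # B) ((A @ [b]) @ x # B)"
    unfolding swap_step_def using Cons.prems(1) swapped nadj by auto
  moreover have "equivclp (swap_step G) ((A @ [b]) @ x # B) ((A @ [b]) @ B @ [x]) \<and>
      admissible G ((A @ [b]) @ B @ [x])"
    by (rule Cons.IH[OF swapped]) (use Cons.prems in auto)
  ultimately show ?case
    by (auto intro: equivclp_trans r_into_equivclp)
qed

lemma swap_equiv_if_mset_eq:
  assumes "admissible G S" "admissible G T" "mset S = mset T"
  shows "equivclp (swap_step G) T S"
  using assms
proof (induction S arbitrary: T rule: rev_induct)
  case Nil
  then show ?case by simp
next
  case (snoc x S)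
  have "x \<in> set T"
    using snoc.prems(3) by (metis in_set_conv_decomp set_mset_mset)
  \<comment> \<open>split at the last occurrence, as \<open>x\<close> may occur several times\<close>
  then obtain A B where T: "T = A @ x # B" and x: "x \<notin> set B"
    using split_list_last by metis
  have mset: "mset S = mset (A @ B)"
    using snoc.prems(3) by (simp add: T)
  have S: "admissible G S"
    using snoc.prems(1) by (simp add: admissible_append)
  have moved: "equivclp (swap_step G) T (A @ B @ [x])" "admissible G (A @ B @ [x])"
    using swap_equiv_move_to_end[of A x B] snoc.prems(2) x feasible_mset_if_admissible[OF S]
    by (simp_all add: T mset)
  have "admissible G (A @ B)"
    using moved(2) admissible_append[of G "A @ B" "[x]"] by simp
  then have "equivclp (swap_step G) (A @ B) S"
    using snoc.IH[OF S _ mset] by blast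
  then have "equivclp (swap_step G) ((A @ B) @ [x]) (S @ [x])"
    using equivclp_swap_append[of "A @ B" S "[x]"] moved(2) by simp
  then show ?case
    using moved(1) equivclp_trans by fastforce
qed

lemma seq_equiv_iff_mset:
  "seq_equiv G S T \<longleftrightarrow> admissible G S \<and> admissible G T \<and> mset S = mset T"
proof -
  have "mset S = mset T" if "equivclp (swap_step G) S T"
    using that
  proof (induction rule: equivclp_induct)
    case base
    then show ?case by simp
  next
    case (step Y Z)
    then show ?case by (auto simp: swap_step_def)
  qed
  then show ?thesis
    unfolding seq_equiv_def using swap_equiv_if_mset_eq[of T S] by auto
qed

end

section \<open>Existence of sequences with given multiplicities\<close>

context acyclic_quiver
begin

lemma wf_converse_arcs_ends: "wf ((arcs_ends G)\<inverse>)"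
proof (rule finite_acyclic_wf_converse)
  show "finite (arcs_ends G)"
    by (simp add: arcs_ends_def)
  show "acyclic (arcs_ends G)"
  proof (rule acyclicI, rule allI, rule notI)
    fix v assume "(v, v) \<in> (arcs_ends G)\<^sup>+"
    then obtain p where "awalk v p v" "p \<noteq> []"
      by (auto simp: reachable1_awalk)
    then have "closed_w p"
      by (auto simp: closed_w_def)
    then show False
      using closed_w_imp_cycle no_oriented_cycle by blast
  qed
qed

text \<open>
  The letter to add is found among the vertices still short of their multiplicity in \<open>N\<close>. An arc
  in its current direction leads from such a vertex to another one; it keeps the multiplicity in
  \<open>M\<close> if it is unreversed and lowers it otherwise. So among the vertices with the least
  multiplicity in \<open>M\<close>, one furthest along the original arcs is a sink. The proof says the same
  with feasibility in place of orientations: an arc is reversed iff the multiplicities in \<open>M\<close> of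
  its ends differ.
\<close>

lemma feasible_step:
  assumes M: "feasible G M" and N: "feasible G N" and sub: "M \<subset># N"
  obtains x where "feasible G (add_mset x M)" "add_mset x M \<subseteq># N"
proof -
  define D where "D = {v. count M v < count N v}"
  have "D \<noteq> {}"
    using sub unfolding D_def
    by (metis (mono_tags, lifting) Collect_empty_eq linorder_not_le subset_mset.less_le_not_le
        mset_subset_eqI)
  then obtain w where w: "w \<in> D" "\<And>v. v \<in> D \<Longrightarrow> count M w \<le> count M v"
    using exists_least_iff[of "\<lambda>k. \<exists>v\<in>D. count M v = k"] by (metis ex_in_conv linorder_not_le)
  define D' where "D' = {v\<in>D. count M v = count M w}"
  have "w \<in> D'" using w by (simp add: D'_def)
  then obtain x where x: "x \<in> D'" and "\<And>y. (y, x) \<in> (arcs_ends G)\<inverse> \<Longrightarrow> y \<notin> D'"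
    using wfE_min[OF wf_converse_arcs_ends] by metis
  then have x_last: "head G e \<notin> D'" if "e \<in> arcs G" "tail G e = x" for e
    using that by (auto simp: arcs_ends_conv)
  have xD: "x \<in> D" and x_least: "\<And>v. v \<in> D \<Longrightarrow> count M x \<le> count M v"
    using x w(2) by (auto simp: D'_def)
  have "feasible G (add_mset x M)"
    unfolding feasible_def
  proof (intro conjI ballI)
    have "x \<in># N" using xD by (auto simp: D_def intro: count_inI)
    then show "set_mset (add_mset x M) \<subseteq> verts G"
      using M N by (auto simp: feasible_def)
  next
    fix e assume e: "e \<in> arcs G"
    note arc = feasible_arcD[OF M e] feasible_arcD[OF N e] no_loops[OF e]
    show "count (add_mset x M) (tail G e) \<le> count (add_mset x M) (head G e)"
    proof (cases "tail G e = x")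
      case True
      have "count M (head G e) \<noteq> count M x"
      proof
        assume eq: "count M (head G e) = count M x"
        then have "head G e \<in> D'"
          using arc xD x True by (auto simp: D_def D'_def)
        then show False using x_last[OF e True] by blast
      qed
      then show ?thesis using arc True by auto
    qed (use arc in auto)
    show "count (add_mset x M) (head G e) \<le> count (add_mset x M) (tail G e) + 1"
    proof (cases "head G e = x")
      case True
      have "count M x \<noteq> count M (tail G e) + 1"
      proof
        assume eq: "count M x = count M (tail G e) + 1"
        then have "tail G e \<in> D"
          using arc xD True by (auto simp: D_def)
        then show False using x_least eq by fastforce
      qed
      then show ?thesis using arc True by auto
    qed (use arc in auto)
  qed
  moreover have "add_mset x M \<subseteq># N"
  proof (rule mset_subset_eqI)
    fix v
    show "count (add_mset x M) v \<le> count N v"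
      using xD sub mset_subset_eq_count[of M N v] by (auto simp: D_def subset_mset.less_le)
  qed
  ultimately show ?thesis using that by blast
qed

lemma admissible_extend:
  assumes "admissible G S" "feasible G N" "mset S \<subseteq># N"
  obtains U where "admissible G (S @ U)" "mset (S @ U) = N"
proof -
  have "\<exists>U. admissible G (S @ U) \<and> mset (S @ U) = N"
    using assms
  proof (induction "size N - size (mset S)" arbitrary: S rule: less_induct)
    case less
    show ?case
    proof (cases "mset S = N")
      case True
      then show ?thesis
        using less.prems(1) by (intro exI[of _ "[]"]) simp
    next
      case False
      then have sub: "mset S \<subset># N"
        using less.prems(3) by auto
      obtain x where x: "feasible G (add_mset x (mset S))" "add_mset x (mset S) \<subseteq># N"
        using feasible_step[OF feasible_mset_if_admissible[OF less.prems(1)] less.prems(2) sub] .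
      have adm: "admissible G (S @ [x])"
        using less.prems(1) x(1) by (simp add: admissible_snoc)
      have "\<exists>U. admissible G ((S @ [x]) @ U) \<and> mset ((S @ [x]) @ U) = N"
      proof (rule less.hyps[OF _ adm less.prems(2)])
        show "size N - size (mset (S @ [x])) < size N - size (mset S)"
          using size_mset_mono[OF x(2)] by simp
        show "mset (S @ [x]) \<subseteq># N"
          using x(2) by simp
      qed
      then show ?thesis
        by (metis append.assoc)
    qed
  qed
  then show ?thesis using that by blast
qed

lemma ex_admissible_with_mset:
  assumes "feasible G M"
  obtains S where "admissible G S" "mset S = M"
  using admissible_extend[of "[]" M] assms by auto

lemma seq_le_iff_mset:
  "seq_le G S T \<longleftrightarrow> admissible G S \<and> admissible G T \<and> mset S \<subseteq># mset T"
proof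
  assume "seq_le G S T"
  then show "admissible G S \<and> admissible G T \<and> mset S \<subseteq># mset T"
    by (auto simp: seq_le_def seq_equiv_iff_mset)
next
  assume *: "admissible G S \<and> admissible G T \<and> mset S \<subseteq># mset T"
  then obtain U where "admissible G (S @ U)" "mset (S @ U) = mset T"
    using admissible_extend[of S "mset T"] feasible_mset_if_admissible[of T] by blast
  then show "seq_le G S T"
    using * by (auto simp: seq_le_def seq_equiv_iff_mset admissible_append intro!: exI[of _ U])
qed

end

section \<open>Segment supports\<close>

lemma count_concat_distinct:
  assumes "\<forall>xs\<in>set xss. distinct xs"
  shows "count (mset (concat xss)) v = card {i. v \<in> segment_supp xss i}"
  using assms
proof (induction xss rule: rev_induct)
  case Nil
  then show ?case by (simp add: segment_supp_def)
next
  case (snoc xs xss)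
  have "{i. v \<in> segment_supp (xss @ [xs]) i} =
      {i. v \<in> segment_supp xss i} \<union> (if v \<in> set xs then {length xss} else {})"
    by (auto simp: segment_supp_def nth_append less_Suc_eq split: if_splits)
  moreover have "finite {i. v \<in> segment_supp xss i}" "length xss \<notin> {i. v \<in> segment_supp xss i}"
    by (auto simp: segment_supp_def intro: finite_subset[of _ "{..<length xss}"] split: if_splits)
  moreover have "count (mset xs) v = (if v \<in> set xs then 1 else 0)"
    using snoc.prems by (simp add: distinct_count_atmost_1)
  ultimately show ?case
    using snoc by auto
qed

lemma mem_down_closed_iff_less_card:
  fixes A :: "nat set"
  assumes "finite A" "\<And>i j. i \<in> A \<Longrightarrow> j \<le> i \<Longrightarrow> j \<in> A"
  shows "i \<in> A \<longleftrightarrow> i < card A"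
proof
  assume "i \<in> A"
  then have "{..i} \<subseteq> A" using assms(2) by auto
  then have "card {..i} \<le> card A" by (rule card_mono[OF assms(1)])
  then show "i < card A" by simp
next
  assume less: "i < card A"
  show "i \<in> A"
  proof (rule ccontr)
    assume "i \<notin> A"
    then have "A \<subseteq> {..<i}" using assms(2) by (metis lessThan_iff linorder_not_le subsetI)
    then have "card A \<le> card {..<i}" by (intro card_mono) auto
    then show False using less by simp
  qed
qed

context loopfree_digraph
begin

text \<open>
  Each support equals the support of all that follows, so the supports decrease. A letter occurs at
  most once per segment, hence lies in exactly the first \<open>k\<close> segments if it occurs \<open>k\<close> times.
\<close>

lemma segment_supp_canonical:
  assumes "canonical_form G S Ss"
  shows "segment_supp Ss i = {v. i < count (mset S) v}"
proof -
  have seg: "distinct (Ss ! i)" "set (Ss ! i) = set (concat (drop i Ss))" if "i < length Ss" for i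
    using assms that by (auto simp: canonical_form_def)
  have "mset S = mset (concat Ss)"
    using assms by (simp add: canonical_form_def seq_equiv_iff_mset)
  moreover have "\<forall>xs\<in>set Ss. distinct xs"
    using seg(1) by (auto simp: in_set_conv_nth)
  ultimately have count: "count (mset S) v = card {i. v \<in> segment_supp Ss i}" for v
    using count_concat_distinct[of Ss v] by simp
  have "v \<in> segment_supp Ss i \<longleftrightarrow> i < count (mset S) v" for v
  proof -
    have "i \<in> {i. v \<in> segment_supp Ss i} \<longleftrightarrow> i < card {i. v \<in> segment_supp Ss i}"
    proof (rule mem_down_closed_iff_less_card)
      show "finite {i. v \<in> segment_supp Ss i}"
        by (rule finite_subset[of _ "{..<length Ss}"]) (auto simp: segment_supp_def split: if_splits)
    next
      fix i j assume "i \<in> {i. v \<in> segment_supp Ss i}" "j \<le> i"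
      then have i: "i < length Ss" "v \<in> set (Ss ! i)" and ji: "j \<le> i"
        by (auto simp: segment_supp_def split: if_splits)
      have "Ss ! i \<in> set (drop j Ss)"
        using i(1) ji by (auto simp: in_set_conv_nth intro!: exI[of _ "i - j"])
      then have "v \<in> set (concat (drop j Ss))"
        using i(2) by auto
      then show "j \<in> {i. v \<in> segment_supp Ss i}"
        using seg(2)[of j] i(1) ji by (simp add: segment_supp_def)
    qed
    then show ?thesis by (simp add: count)
  qed
  then show ?thesis by auto
qed

lemma less_length_canonical_iff:
  assumes "canonical_form G S Ss"
  shows "i < length Ss \<longleftrightarrow> (\<exists>v. i < count (mset S) v)"
proof -
  have "Ss ! i \<noteq> []" if "i < length Ss"
    using assms that unfolding canonical_form_def by blast
  then have "i < length Ss \<longleftrightarrow> segment_supp Ss i \<noteq> {}"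
    by (auto simp: segment_supp_def)
  then show ?thesis
    by (simp add: segment_supp_canonical[OF assms])
qed

end

context acyclic_quiver
begin

text \<open>
  Cutting all multiplicities down to \<open>k\<close> keeps a multiset feasible. Raising \<open>k\<close> by one adds
  every letter that occurs more than \<open>k\<close> times just once, and by \<open>admissible_extend\<close>
  these letters can be arranged into a segment.
\<close>

lemma ex_segments_of_truncation:
  assumes "feasible G M"
  shows "\<exists>Ss. length Ss = k \<and> admissible G (concat Ss) \<and>
    mset (concat Ss) = M \<inter># repeat_mset k (mset_set (verts G)) \<and>
    (\<forall>i<k. distinct (Ss ! i) \<and> set (Ss ! i) = {v. i < count M v})"
proof (induction k)
  case 0
  then show ?case by simp
next
  case (Suc k)
  define T where "T k = M \<inter># repeat_mset k (mset_set (verts G))" for k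
  have "v \<in> verts G" if "count M v > 0" for v
    using assms that by (auto simp: feasible_def)
  then have count_T: "count (T k) v = min (count M v) k" for k v
    by (cases "v \<in> verts G") (auto simp: T_def min_def)
  have "feasible G (repeat_mset k (mset_set (verts G)))" for k
    unfolding feasible_def by (auto simp: count_greater_zero_iff[symmetric] count_mset_set'
        simp del: count_greater_zero_iff split: if_splits)
  then have feas: "feasible G (T k)" for k
    unfolding T_def using assms by (intro feasible_inter)
  from Suc obtain Ss where Ss: "length Ss = k" "admissible G (concat Ss)" "mset (concat Ss) = T k"
    "\<And>i. i < k \<Longrightarrow> distinct (Ss ! i) \<and> set (Ss ! i) = {v. i < count M v}"
    unfolding T_def by blast
  have "mset (concat Ss) \<subseteq># T (Suc k)"
    unfolding Ss(3) by (rule mset_subset_eqI) (simp add: count_T)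
  then obtain U where U: "admissible G (concat Ss @ U)" "mset (concat Ss @ U) = T (Suc k)"
    using admissible_extend[OF Ss(2) feas] by metis
  have count_U: "count (mset U) v = (if k < count M v then 1 else 0)" for v
  proof -
    have "min (count M v) k + count (mset U) v = min (count M v) (Suc k)"
      using arg_cong[OF U(2), of "\<lambda>M. count M v"] Ss(3) by (simp add: count_T)
    then show ?thesis by auto
  qed
  have setU: "set U = {v. k < count M v}"
    using count_U by (metis (mono_tags, lifting) Collect_cong count_eq_zero_iff set_mset_mset
        one_neq_zero set_mset_def Collect_mem_eq not_gr_zero)
  have "distinct U"
    using count_U setU by (auto simp: distinct_count_atmost_1)
  then show ?case
    using Ss U setU unfolding T_def
    by (intro exI[of _ "Ss @ [U]"]) (auto simp: nth_append less_Suc_eq)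
qed

lemma ex_canonical_form:
  assumes "admissible G S"
  shows "\<exists>Ss. canonical_form G S Ss"
proof -
  let ?M = "mset S"
  note feas = feasible_mset_if_admissible[OF assms]
  \<comment> \<open>as many segments as the largest multiplicity, so that none of them is empty\<close>
  define k where "k = Max (count ?M ` verts G)"
  have ne: "verts G \<noteq> {}"
    using more_than_one_vertex by auto
  have le: "count ?M v \<le> k" if "v \<in> verts G" for v
    unfolding k_def using that by auto
  have "k \<in> count ?M ` verts G"
    unfolding k_def by (rule Max_in) (use ne in auto)
  then obtain w where w: "count ?M w = k" by blast
  obtain Ss where Ss: "length Ss = k" "admissible G (concat Ss)"
    "mset (concat Ss) = ?M \<inter># repeat_mset k (mset_set (verts G))"
    "\<And>i. i < k \<Longrightarrow> distinct (Ss ! i) \<and> set (Ss ! i) = {v. i < count ?M v}"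
    using ex_segments_of_truncation[OF feas, of k] by blast
  have "?M \<inter># repeat_mset k (mset_set (verts G)) = ?M"
  proof (rule multiset_eqI)
    fix v
    show "count (?M \<inter># repeat_mset k (mset_set (verts G))) v = count ?M v"
    proof (cases "v \<in> verts G")
      case True
      then show ?thesis using le[OF True] by simp
    next
      case False
      then have "count ?M v = 0"
        using feas unfolding feasible_def by (metis count_inI subsetD)
      then show ?thesis by (metis count_inter_mset min_0L)
    qed
  qed
  then have "seq_equiv G S (concat Ss)"
    using assms Ss by (simp add: seq_equiv_iff_mset)
  moreover have "Ss ! i \<noteq> [] \<and> distinct (Ss ! i) \<and> set (Ss ! i) = set (concat (drop i Ss))"
    if i: "i < length Ss" for i
  proof -
    have "w \<in> set (Ss ! i)"
      using Ss i w by simp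
    moreover have "set xs \<subseteq> set (Ss ! i)" if "xs \<in> set (drop i Ss)" for xs
    proof -
      from that obtain j where "j < length Ss - i" "xs = Ss ! (i + j)"
        by (auto simp: in_set_conv_nth)
      then show ?thesis using Ss(1,4) i by auto
    qed
    moreover have "Ss ! i \<in> set (drop i Ss)"
      using i by (metis Cons_nth_drop_Suc list.set_intros(1))
    ultimately show ?thesis
      using Ss(1,4) i by (fastforce simp: set_concat)
  qed
  ultimately have "canonical_form G S Ss"
    by (simp add: canonical_form_def)
  then show ?thesis by blast
qed

text \<open>
  In the segment list of \<open>S \<and> T\<close> the segments may be empty, so it is not a canonical form itself;
  but counting a letter only requires every segment to be repetition-free.
\<close>

lemma is_wedge_iff_mset:
  assumes S: "admissible G S" and T: "admissible G T"
  shows "is_wedge G S T R \<longleftrightarrow> admissible G R \<and> mset R = mset S \<inter># mset T"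
proof (cases "S = [] \<or> T = []")
  case True
  then show ?thesis
    by (auto simp: is_wedge_def seq_equiv_iff_mset)
next
  case False
  show ?thesis
  proof
    assume "is_wedge G S T R"
    with False obtain Ss Ts Rs where Ss: "canonical_form G S Ss" and Ts: "canonical_form G T Ts"
      and len: "length Rs = min (length Ss) (length Ts)"
      and Rs: "\<forall>i<length Rs. set (Rs ! i) = segment_supp Ss i \<inter> segment_supp Ts i"
      and R: "canonical_form G R (filter (\<lambda>seg. seg \<noteq> []) Rs)"
      unfolding is_wedge_def by auto
    let ?Rs' = "filter (\<lambda>seg. seg \<noteq> []) Rs"
    have "concat ?Rs' = concat Rs"
      by (induction Rs) auto
    then have adm: "admissible G R" and mset: "mset R = mset (concat Rs)"
      using R by (simp_all add: canonical_form_def seq_equiv_iff_mset)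
    have "distinct xs" if "xs \<in> set ?Rs'" for xs
      using that R unfolding canonical_form_def by (metis in_set_conv_nth)
    then have dist: "\<forall>xs\<in>set Rs. distinct xs"
      by (metis (mono_tags, lifting) distinct.simps(1) mem_Collect_eq set_filter)
    have supp: "segment_supp Rs i = segment_supp Ss i \<inter> segment_supp Ts i" for i
      using Rs len by (auto simp: segment_supp_def)
    have "count (mset R) v = count (mset S \<inter># mset T) v" for v
    proof -
      have "{i. v \<in> segment_supp Rs i} = {..<min (count (mset S) v) (count (mset T) v)}"
        by (auto simp: supp segment_supp_canonical[OF Ss] segment_supp_canonical[OF Ts])
      then show ?thesis
        using count_concat_distinct[OF dist, of v] by (simp add: mset)
    qed
    then show "admissible G R \<and> mset R = mset S \<inter># mset T"
      using adm by (auto intro: multiset_eqI)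
  next
    assume R: "admissible G R \<and> mset R = mset S \<inter># mset T"
    obtain Ss Ts Rs where Ss: "canonical_form G S Ss" and Ts: "canonical_form G T Ts"
      and Rs: "canonical_form G R Rs"
      using S T R ex_canonical_form by metis
    have "i < length Ss" "i < length Ts" if "i < length Rs" for i
      using that R by (auto simp: less_length_canonical_iff[OF Ss] less_length_canonical_iff[OF Ts]
          less_length_canonical_iff[OF Rs])
    then have len: "length Rs \<le> min (length Ss) (length Ts)"
      by (metis linorder_not_le min_less_iff_conj order_less_irrefl)
    define Rs' where "Rs' = Rs @ replicate (min (length Ss) (length Ts) - length Rs) []"
    have "segment_supp Rs' i = segment_supp Rs i" for i
      by (auto simp: Rs'_def segment_supp_def nth_append)
    then have supp: "segment_supp Rs' i = segment_supp Ss i \<inter> segment_supp Ts i" for i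
      using R by (auto simp: segment_supp_canonical[OF Ss] segment_supp_canonical[OF Ts]
          segment_supp_canonical[OF Rs])
    have "xs \<noteq> []" if "xs \<in> set Rs" for xs
      using that Rs unfolding canonical_form_def by (metis in_set_conv_nth)
    then have "filter (\<lambda>seg. seg \<noteq> []) Rs' = Rs"
      by (simp add: Rs'_def filter_replicate)
    then have can: "canonical_form G R (filter (\<lambda>seg. seg \<noteq> []) Rs')"
      using Rs by (rule ssubst)
    have "length Rs' = min (length Ss) (length Ts)"
      using len by (simp add: Rs'_def)
    moreover have "\<forall>i<length Rs'. set (Rs' ! i) = segment_supp Ss i \<inter> segment_supp Ts i"
      using supp by (metis segment_supp_def)
    ultimately show "is_wedge G S T R"
      using False Ss Ts can unfolding is_wedge_def
      by (subst if_not_P) (blast intro: exI[of _ Ss] exI[of _ Ts] exI[of _ Rs'])+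
  qed
qed

lemma is_vee_iff_mset:
  assumes S: "admissible G S" and T: "admissible G T"
  shows "is_vee G S T R \<longleftrightarrow> admissible G R \<and> mset R = mset S \<union># mset T"
proof (cases "S = [] \<or> T = []")
  case True
  then show ?thesis
    using S T by (auto simp: is_vee_def seq_equiv_iff_mset)
next
  case False
  show ?thesis
  proof
    assume "is_vee G S T R"
    with False obtain Ss Ts Rs where Ss: "canonical_form G S Ss" and Ts: "canonical_form G T Ts"
      and len: "length Rs = max (length Ss) (length Ts)"
      and Rs: "\<forall>i<length Rs. set (Rs ! i) = segment_supp Ss i \<union> segment_supp Ts i"
      and R: "canonical_form G R Rs"
      unfolding is_vee_def by auto
    have supp: "segment_supp Rs i = segment_supp Ss i \<union> segment_supp Ts i" for i
      using Rs len by (auto simp: segment_supp_def)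
    have "i < count (mset R) v \<longleftrightarrow> i < count (mset S \<union># mset T) v" for i v
    proof -
      have "v \<in> segment_supp Rs i \<longleftrightarrow> v \<in> segment_supp Ss i \<or> v \<in> segment_supp Ts i"
        by (simp add: supp)
      then show ?thesis
        by (simp add: segment_supp_canonical[OF Ss] segment_supp_canonical[OF Ts]
            segment_supp_canonical[OF R] less_max_iff_disj)
    qed
    then have "mset R = mset S \<union># mset T"
      by (intro multiset_eqI) (metis linorder_neqE_nat order_less_irrefl)
    then show "admissible G R \<and> mset R = mset S \<union># mset T"
      using R by (simp add: canonical_form_def seq_equiv_iff_mset)
  next
    assume R: "admissible G R \<and> mset R = mset S \<union># mset T"
    obtain Ss Ts Rs where Ss: "canonical_form G S Ss" and Ts: "canonical_form G T Ts"
      and Rs: "canonical_form G R Rs"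
      using S T R ex_canonical_form by metis
    have "i < length Rs \<longleftrightarrow> i < max (length Ss) (length Ts)" for i
      using R by (auto simp: less_length_canonical_iff[OF Ss] less_length_canonical_iff[OF Ts]
          less_length_canonical_iff[OF Rs] less_max_iff_disj)
    then have len: "length Rs = max (length Ss) (length Ts)"
      by (metis linorder_neqE_nat order_less_irrefl)
    have "segment_supp Rs i = segment_supp Ss i \<union> segment_supp Ts i" for i
      using R by (auto simp: segment_supp_canonical[OF Ss] segment_supp_canonical[OF Ts]
          segment_supp_canonical[OF Rs])
    then have "\<forall>i<length Rs. set (Rs ! i) = segment_supp Ss i \<union> segment_supp Ts i"
      by (metis segment_supp_def)
    then show "is_vee G S T R"
      using False Ss Ts Rs len unfolding is_vee_def
      by (metis (mono_tags, lifting))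
  qed
qed

section \<open>The lattice of equivalence classes\<close>

lemma seq_class_eq_mset:
  "admissible G S \<Longrightarrow> seq_class G S = {T. admissible G T \<and> mset T = mset S}"
  by (auto simp: seq_class_def seq_equiv_iff_mset)

lemma carrier_seq_poset: "carrier (seq_poset G) = seq_class G ` {S. admissible G S}"
  by (auto simp: seq_poset_def quotient_def seq_class_def)

lemma le_seq_class_iff:
  assumes "admissible G S" "admissible G T"
  shows "seq_class G S \<sqsubseteq>\<^bsub>seq_poset G\<^esub> seq_class G T \<longleftrightarrow> mset S \<subseteq># mset T"
proof -
  have "seq_class G S \<sqsubseteq>\<^bsub>seq_poset G\<^esub> seq_class G T \<longleftrightarrow>
      (\<exists>S'\<in>seq_class G S. \<exists>T'\<in>seq_class G T. seq_le G S' T')"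
    by (simp add: seq_poset_def)
  also have "\<dots> \<longleftrightarrow> mset S \<subseteq># mset T"
    unfolding seq_class_eq_mset[OF assms(1)] seq_class_eq_mset[OF assms(2)] seq_le_iff_mset
    using assms by auto
  finally show ?thesis .
qed

lemma partial_order_seq_poset: "partial_order (seq_poset G)"
proof
  fix x assume "x \<in> carrier (seq_poset G)"
  then show "x \<sqsubseteq>\<^bsub>seq_poset G\<^esub> x"
    by (auto simp: carrier_seq_poset le_seq_class_iff)
next
  fix x y
  assume "x \<sqsubseteq>\<^bsub>seq_poset G\<^esub> y" "y \<sqsubseteq>\<^bsub>seq_poset G\<^esub> x"
    "x \<in> carrier (seq_poset G)" "y \<in> carrier (seq_poset G)"
  then obtain S T where "x = seq_class G S" "y = seq_class G T"
    "admissible G S" "admissible G T" "mset S = mset T"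
    unfolding carrier_seq_poset
    by (elim imageE) (auto simp: le_seq_class_iff dest: subset_mset.antisym)
  then have "x = y"
    by (simp add: seq_class_eq_mset)
  then show "x .=\<^bsub>seq_poset G\<^esub> y"
    by (simp add: seq_poset_def)
next
  fix x y z
  assume "x \<sqsubseteq>\<^bsub>seq_poset G\<^esub> y" "y \<sqsubseteq>\<^bsub>seq_poset G\<^esub> z"
    "x \<in> carrier (seq_poset G)" "y \<in> carrier (seq_poset G)" "z \<in> carrier (seq_poset G)"
  then show "x \<sqsubseteq>\<^bsub>seq_poset G\<^esub> z"
    by (auto simp: carrier_seq_poset le_seq_class_iff intro: subset_mset.order_trans)
qed (auto simp: seq_poset_def)

lemma greatest_Lower_seq_class:
  assumes "admissible G S" "admissible G T" "admissible G R" "mset R = mset S \<inter># mset T"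
  shows "greatest (seq_poset G) (seq_class G R) (Lower (seq_poset G) {seq_class G S, seq_class G T})"
proof (rule greatest_LowerI)
  show "seq_class G R \<sqsubseteq>\<^bsub>seq_poset G\<^esub> x" if "x \<in> {seq_class G S, seq_class G T}" for x
    using that assms(4) by (elim insertE emptyE) (simp_all add: le_seq_class_iff assms(1-3))
next
  fix y assume y: "y \<in> Lower (seq_poset G) {seq_class G S, seq_class G T}"
  then have "y \<in> seq_class G ` {S. admissible G S}"
    using Lower_closed subsetD carrier_seq_poset by metis
  then obtain U where U: "admissible G U" "y = seq_class G U"
    by (elim imageE) simp
  have "y \<sqsubseteq>\<^bsub>seq_poset G\<^esub> seq_class G S" "y \<sqsubseteq>\<^bsub>seq_poset G\<^esub> seq_class G T"
    using y assms(1,2) by (simp_all add: Lower_def carrier_seq_poset)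
  then show "y \<sqsubseteq>\<^bsub>seq_poset G\<^esub> seq_class G R"
    using U assms by (simp add: le_seq_class_iff)
qed (use assms in \<open>simp_all add: carrier_seq_poset\<close>)

lemma least_Upper_seq_class:
  assumes "admissible G S" "admissible G T" "admissible G R" "mset R = mset S \<union># mset T"
  shows "least (seq_poset G) (seq_class G R) (Upper (seq_poset G) {seq_class G S, seq_class G T})"
proof (rule least_UpperI)
  show "x \<sqsubseteq>\<^bsub>seq_poset G\<^esub> seq_class G R" if "x \<in> {seq_class G S, seq_class G T}" for x
    using that assms(4) by (elim insertE emptyE) (simp_all add: le_seq_class_iff assms(1-3))
next
  fix y assume y: "y \<in> Upper (seq_poset G) {seq_class G S, seq_class G T}"
  then have "y \<in> seq_class G ` {S. admissible G S}"
    using Upper_closed subsetD carrier_seq_poset by metis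
  then obtain U where U: "admissible G U" "y = seq_class G U"
    by (elim imageE) simp
  have "seq_class G S \<sqsubseteq>\<^bsub>seq_poset G\<^esub> y" "seq_class G T \<sqsubseteq>\<^bsub>seq_poset G\<^esub> y"
    using y assms(1,2) by (simp_all add: Upper_def carrier_seq_poset)
  then show "seq_class G R \<sqsubseteq>\<^bsub>seq_poset G\<^esub> y"
    using U assms by (simp add: le_seq_class_iff)
qed (use assms in \<open>simp_all add: carrier_seq_poset\<close>)

lemma ex_admissible_inter:
  assumes "admissible G S" "admissible G T"
  obtains R where "admissible G R" "mset R = mset S \<inter># mset T"
  using that by (rule ex_admissible_with_mset
      [OF feasible_inter[OF assms[THEN feasible_mset_if_admissible]]])

lemma ex_admissible_union:
  assumes "admissible G S" "admissible G T"
  obtains R where "admissible G R" "mset R = mset S \<union># mset T"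
  using that by (rule ex_admissible_with_mset
      [OF feasible_union[OF assms[THEN feasible_mset_if_admissible]]])

lemma lattice_seq_poset: "Lattice.lattice (seq_poset G)"
proof -
  interpret partial_order "seq_poset G" by (rule partial_order_seq_poset)
  show ?thesis
  proof
    fix x y assume "x \<in> carrier (seq_poset G)" "y \<in> carrier (seq_poset G)"
    then obtain S T where ST: "admissible G S" "admissible G T"
      "x = seq_class G S" "y = seq_class G T"
      by (auto simp: carrier_seq_poset)
    show "\<exists>s. least (seq_poset G) s (Upper (seq_poset G) {x, y})"
      unfolding ST(3,4) by (rule ex_admissible_union[OF ST(1,2)])
        (blast intro: least_Upper_seq_class[OF ST(1,2)])
    show "\<exists>s. greatest (seq_poset G) s (Lower (seq_poset G) {x, y})"
      unfolding ST(3,4) by (rule ex_admissible_inter[OF ST(1,2)])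
        (blast intro: greatest_Lower_seq_class[OF ST(1,2)])
  qed
qed

lemma meet_seq_class:
  assumes "admissible G S" "admissible G T" "admissible G R" "mset R = mset S \<inter># mset T"
  shows "seq_class G S \<sqinter>\<^bsub>seq_poset G\<^esub> seq_class G T = seq_class G R"
proof -
  interpret Lattice.lattice "seq_poset G" by (rule lattice_seq_poset)
  have "seq_class G S \<in> carrier (seq_poset G)" "seq_class G T \<in> carrier (seq_poset G)"
    using assms by (auto simp: carrier_seq_poset)
  then show ?thesis
    by (rule meetI[where P = "\<lambda>z. z = seq_class G R", rotated])
      (rule greatest_unique[OF _ greatest_Lower_seq_class[OF assms]])
qed

lemma join_seq_class:
  assumes "admissible G S" "admissible G T" "admissible G R" "mset R = mset S \<union># mset T"
  shows "seq_class G S \<squnion>\<^bsub>seq_poset G\<^esub> seq_class G T = seq_class G R"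
proof -
  interpret Lattice.lattice "seq_poset G" by (rule lattice_seq_poset)
  have "seq_class G S \<in> carrier (seq_poset G)" "seq_class G T \<in> carrier (seq_poset G)"
    using assms by (auto simp: carrier_seq_poset)
  then show ?thesis
    by (rule joinI[where P = "\<lambda>z. z = seq_class G R", rotated])
      (rule least_unique[OF _ least_Upper_seq_class[OF assms]])
qed

end

theorem proposition2p6:
  fixes G :: "('a, 'b) pre_digraph"
  assumes "acyclic_quiver G"
  shows "lattice (seq_poset G) \<and>
    (\<forall>S T. admissible G S \<and> admissible G T \<longrightarrow>
      (\<exists>R. is_wedge G S T R) \<and>
      (\<forall>R. is_wedge G S T R \<longrightarrow>
        seq_class G S \<sqinter>\<^bsub>seq_poset G\<^esub> seq_class G T = seq_class G R) \<and>
      (\<exists>R. is_vee G S T R) \<and>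
      (\<forall>R. is_vee G S T R \<longrightarrow>
        seq_class G S \<squnion>\<^bsub>seq_poset G\<^esub> seq_class G T = seq_class G R))"
proof -
  interpret acyclic_quiver G by (rule assms)
  show ?thesis
  proof (intro conjI allI impI)
    show "Lattice.lattice (seq_poset G)" by (rule lattice_seq_poset)
  next
    fix S T assume "admissible G S \<and> admissible G T"
    then have S: "admissible G S" and T: "admissible G T" by auto
    note wedge = is_wedge_iff_mset[OF S T] and vee = is_vee_iff_mset[OF S T]
    show "\<exists>R. is_wedge G S T R"
      using ex_admissible_inter[OF S T] unfolding wedge by blast
    show "\<exists>R. is_vee G S T R"
      using ex_admissible_union[OF S T] unfolding vee by blast
    fix R
    show "seq_class G S \<sqinter>\<^bsub>seq_poset G\<^esub> seq_class G T = seq_class G R" if "is_wedge G S T R"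
      using that meet_seq_class[OF S T] unfolding wedge by blast
    show "seq_class G S \<squnion>\<^bsub>seq_poset G\<^esub> seq_class G T = seq_class G R" if "is_vee G S T R"
      using that join_seq_class[OF S T] unfolding vee by blast
  qed
qed

end
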